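(* Let $A=(a_{ij})$ and $B=(b_{ij})$ be real $I\times J$ conditional probability matrices, i.e. $a_{ij}\ge 0$, $b_{ij}\ge 0$, $\sum_{i=1}^{I}a_{ij}=1$ for every $j=1,\dots,J$, and $\sum_{j=1}^{J}b_{ij}=1$ for every $i=1,\dots,I$, with $I\le J$. Let $D$ be the $IJ\times I$ coefficient matrix of the homogeneous linear system $$a_{ij}\sum_{s=1}^{I}b_{sj}\eta_s-b_{ij}\eta_i=0\qquad (1\le i\le I,\ 1\le j\le J)$$ in the unknowns $\eta_1,\dots,\eta_I$. Then $A$ and $B$ are compatible if $\operatorname{rank}(D)\le I-1$, with equality $\operatorname{rank}(D)=I-1$ when there exists a unique probability vector $\eta=(\eta_1,\dots,\eta_I)$ (that is, $\eta_i\ge 0$ and $\sum_{i=1}^I\eta_i=1$) with $D\eta=0$.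
   Context: The matrices $A$ and $B$ are called compatible if there exist stochastic (probability) vectors $\tau=(\tau_1,\dots,\tau_J)$ and $\eta=(\eta_1,\dots,\eta_I)$ (non-negative entries summing to $1$) such that $a_{ij}\tau_j=b_{ij}\eta_i$ for every $(i,j)$; then $p_{ij}=a_{ij}\tau_j=b_{ij}\eta_i$ is a joint probability matrix. The rows of $D$ are indexed by pairs $(i,j)$; the entry of $D$ in row $(i,j)$ and column $s$ is $a_{ij}b_{sj}$ if $s\ne i$ and $(a_{ij}-1)b_{ij}$ if $s=i$. *)

theory Defs
  imports "HOL-Analysis.Analysis"
begin

text \<open>An \<open>I \<times> J\<close> matrix has type \<^typ>\<open>real ^ 'j ^ 'i\<close>: the entry in row \<open>i\<close>, column \<open>j\<close> is \<open>A $ i $ j\<close>.\<close>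

definition stochastic_vec :: "real ^ 'n \<Rightarrow> bool" where
  "stochastic_vec x \<longleftrightarrow> (\<forall>i. 0 \<le> x $ i) \<and> (\<Sum>i\<in>UNIV. x $ i) = 1"

text \<open>\<open>A\<close> is conditional given the column (its columns are distributions), \<open>B\<close> given the row.\<close>

definition cond_prob_given_col :: "real ^ 'j ^ 'i \<Rightarrow> bool" where
  "cond_prob_given_col A \<longleftrightarrow> (\<forall>i j. 0 \<le> A $ i $ j) \<and> (\<forall>j. (\<Sum>i\<in>UNIV. A $ i $ j) = 1)"

definition cond_prob_given_row :: "real ^ 'j ^ 'i \<Rightarrow> bool" where
  "cond_prob_given_row B \<longleftrightarrow> (\<forall>i j. 0 \<le> B $ i $ j) \<and> (\<forall>i. (\<Sum>j\<in>UNIV. B $ i $ j) = 1)"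

definition compatible :: "real ^ 'j ^ 'i \<Rightarrow> real ^ 'j ^ 'i \<Rightarrow> bool" where
  "compatible A B \<longleftrightarrow>
     (\<exists>(\<tau> :: real ^ 'j) (\<eta> :: real ^ 'i). stochastic_vec \<tau> \<and> stochastic_vec \<eta> \<and>
        (\<forall>i j. A $ i $ j * \<tau> $ j = B $ i $ j * \<eta> $ i))"

definition coeff_matrix :: "real ^ 'j ^ 'i \<Rightarrow> real ^ 'j ^ 'i \<Rightarrow> real ^ 'i ^ ('i \<times> 'j)" where
  "coeff_matrix A B =
     (\<chi> r s. case r of (i, j) \<Rightarrow>
        if s = i then (A $ i $ j - 1) * B $ i $ j else A $ i $ j * B $ s $ j)"

lemma coeff_matrix_mult_vec_nth:
  fixes A B :: "real ^ 'j ^ 'i" and \<eta> :: "real ^ 'i"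
  shows "(coeff_matrix A B *v \<eta>) $ (i, j) =
           A $ i $ j * (\<Sum>s\<in>UNIV. B $ s $ j * \<eta> $ s) - B $ i $ j * \<eta> $ i"
proof -
  have "(coeff_matrix A B *v \<eta>) $ (i, j) =
      (\<Sum>s\<in>UNIV. A $ i $ j * (B $ s $ j * \<eta> $ s) - (if s = i then B $ i $ j * \<eta> $ i else 0))"
    unfolding matrix_vector_mult_def coeff_matrix_def
    by (simp, intro sum.cong) (auto simp: algebra_simps)
  also have "\<dots> = A $ i $ j * (\<Sum>s\<in>UNIV. B $ s $ j * \<eta> $ s) - B $ i $ j * \<eta> $ i"
    by (simp add: sum_subtractf sum_distrib_left)
  finally show ?thesis .
qed

end

theory Submission
  imports Defs
begin

text \<open>If \<open>D v = 0\<close>, then \<open>a\<^sub>i\<^sub>j t\<^sub>j = b\<^sub>i\<^sub>j v\<^sub>i\<close> with \<open>t\<^sub>j = (\<Sum>s. b\<^sub>s\<^sub>j v\<^sub>s)\<close>. Taking absolute values and summing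
  over \<open>i\<close> gives \<open>\<bar>t\<^sub>j\<bar> = (\<Sum>s. b\<^sub>s\<^sub>j \<bar>v\<^sub>s\<bar>)\<close>, so the kernel of \<open>D\<close> is closed under entrywise absolute values.
  Hence a nontrivial kernel contains a probability vector, and since \<open>v\<close> is half the difference of the nonnegative
  kernel vectors \<open>\<bar>v\<bar> + v\<close> and \<open>\<bar>v\<bar> - v\<close>, a unique probability vector in the kernel spans it.\<close>

lemma coeff_matrix_kernel_iff:
  fixes A B :: "real ^ 'j ^ 'i"
  shows "coeff_matrix A B *v v = 0 \<longleftrightarrow>
    (\<forall>i j. A $ i $ j * (\<Sum>s\<in>UNIV. B $ s $ j * v $ s) = B $ i $ j * v $ i)"
  by (simp add: vec_eq_iff coeff_matrix_mult_vec_nth split_paired_All del: vec_lambda_beta)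

lemma coeff_matrix_kernel_abs:
  fixes A B :: "real ^ 'j ^ 'i"
  assumes A: "cond_prob_given_col A" and B: "cond_prob_given_row B"
    and v: "coeff_matrix A B *v v = 0"
  shows "coeff_matrix A B *v (\<chi> i. \<bar>v $ i\<bar>) = 0"
proof -
  define t where "t j = (\<Sum>s\<in>UNIV. B $ s $ j * v $ s)" for j
  \<comment> \<open>Entries of \<open>A\<close> and \<open>B\<close> are nonnegative, so absolute
    values pass through to \<open>t j\<close> and \<open>v $ i\<close>.\<close>
  have eq: "A $ i $ j * \<bar>t j\<bar> = B $ i $ j * \<bar>v $ i\<bar>" for i j
  proof -
    have "\<bar>A $ i $ j * t j\<bar> = \<bar>B $ i $ j * v $ i\<bar>"
      using v by (simp add: coeff_matrix_kernel_iff t_def)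
    then show ?thesis
      using A B by (simp add: abs_mult cond_prob_given_col_def cond_prob_given_row_def)
  qed
  have "(\<Sum>s\<in>UNIV. B $ s $ j * \<bar>v $ s\<bar>) = \<bar>t j\<bar>" for j
  proof -
    have "(\<Sum>s\<in>UNIV. B $ s $ j * \<bar>v $ s\<bar>) = (\<Sum>s\<in>UNIV. A $ s $ j) * \<bar>t j\<bar>"
      by (simp add: eq sum_distrib_right)
    then show ?thesis
      using A by (simp add: cond_prob_given_col_def)
  qed
  then show ?thesis
    by (simp add: coeff_matrix_kernel_iff eq)
qed

lemma stochastic_vec_normalize:
  fixes v :: "real ^ 'n"
  assumes nonneg: "\<And>i. 0 \<le> v $ i" and "v \<noteq> 0"
  shows "0 < (\<Sum>i\<in>UNIV. v $ i)"
    and "stochastic_vec ((1 / (\<Sum>i\<in>UNIV. v $ i)) *\<^sub>R v)"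
proof -
  have "(\<Sum>i\<in>UNIV. v $ i) \<noteq> 0"
    using assms by (auto simp: sum_nonneg_eq_0_iff vec_eq_iff)
  then show pos: "0 < (\<Sum>i\<in>UNIV. v $ i)"
    using nonneg by (simp add: sum_nonneg order_less_le)
  have "(\<Sum>i\<in>UNIV. ((1 / (\<Sum>k\<in>UNIV. v $ k)) *\<^sub>R v) $ i) =
      1 / (\<Sum>k\<in>UNIV. v $ k) * (\<Sum>i\<in>UNIV. v $ i)"
    unfolding sum_distrib_left by simp
  then show "stochastic_vec ((1 / (\<Sum>i\<in>UNIV. v $ i)) *\<^sub>R v)"
    using pos nonneg by (simp add: stochastic_vec_def)
qed

text \<open>When the columns of \<open>A\<close> sum to 1, summing the compatibility equations over
  \<open>i\<close> leaves only one candidate for \<tau>, the column marginal of \<open>B\<close>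
  weighted by \<eta>. With this choice the kernel equations are the compatibility equations, and the
  unit row sums of \<open>B\<close> give \<tau> total mass 1.\<close>

lemma compatible_if_kernel_stochastic:
  fixes A B :: "real ^ 'j ^ 'i"
  assumes B: "cond_prob_given_row B" and \<eta>: "stochastic_vec \<eta>"
    and ker: "coeff_matrix A B *v \<eta> = 0"
  shows "compatible A B"
proof -
  define \<tau> :: "real ^ 'j" where "\<tau> = (\<chi> j. \<Sum>s\<in>UNIV. B $ s $ j * \<eta> $ s)"
  have "(\<Sum>j\<in>UNIV. \<tau> $ j) = (\<Sum>s\<in>UNIV. \<Sum>j\<in>UNIV. B $ s $ j * \<eta> $ s)"
    unfolding \<tau>_def by (simp add: sum.swap[of _ "UNIV :: 'i set"])
  also have "\<dots> = (\<Sum>s\<in>UNIV. (\<Sum>j\<in>UNIV. B $ s $ j) * \<eta> $ s)"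
    by (simp add: sum_distrib_right)
  also have "\<dots> = 1"
    using B \<eta> by (simp add: cond_prob_given_row_def stochastic_vec_def)
  finally have "stochastic_vec \<tau>"
    using B \<eta> by (simp add: stochastic_vec_def \<tau>_def cond_prob_given_row_def sum_nonneg)
  moreover have "\<forall>i j. A $ i $ j * \<tau> $ j = B $ i $ j * \<eta> $ i"
    using ker by (simp add: coeff_matrix_kernel_iff \<tau>_def)
  ultimately show ?thesis
    using \<eta> unfolding compatible_def by blast
qed

lemma coeff_matrix_kernel_eq_span:
  fixes A B :: "real ^ 'j ^ 'i"
  assumes A: "cond_prob_given_col A" and B: "cond_prob_given_row B"
    and ker: "coeff_matrix A B *v \<eta> = 0"
    and uniq: "\<And>\<zeta>. stochastic_vec \<zeta> \<Longrightarrow> coeff_matrix A B *v \<zeta> = 0 \<Longrightarrow> \<zeta> = \<eta>"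
  shows "{v. coeff_matrix A B *v v = 0} = span {\<eta>}"
proof (intro equalityI subsetI)
  \<comment> \<open>A nonzero nonnegative kernel vector can be rescaled to a probability vector,
    which uniqueness identifies with \<eta>.\<close>
  have nonneg_span: "v \<in> span {\<eta>}"
    if nonneg: "\<And>i. 0 \<le> v $ i" and v: "coeff_matrix A B *v v = 0" for v
  proof (cases "v = 0")
    case False
    let ?c = "\<Sum>i\<in>UNIV. v $ i"
    have "(1 / ?c) *\<^sub>R v = \<eta>"
      using stochastic_vec_normalize(2)[OF nonneg False] v
      by (intro uniq) (simp_all add: matrix_vector_mult_scaleR)
    moreover have "0 < ?c"
      using stochastic_vec_normalize(1)[OF nonneg False] .
    ultimately have "v = ?c *\<^sub>R \<eta>"
      by auto
    then show ?thesis
      by (metis span_base span_scale singletonI)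
  qed (simp add: span_zero)
  fix v assume "v \<in> {v. coeff_matrix A B *v v = 0}"
  then have v: "coeff_matrix A B *v v = 0" by simp
  define w where "w = (\<chi> i. \<bar>v $ i\<bar>)"
  have w: "coeff_matrix A B *v w = 0"
    unfolding w_def using coeff_matrix_kernel_abs[OF A B v] .
  \<comment> \<open>Both vectors are nonnegative because each entry of \<open>w\<close> dominates
    the absolute value of that of \<open>v\<close>.\<close>
  have "w + v \<in> span {\<eta>}" "w - v \<in> span {\<eta>}"
    by (rule nonneg_span;
        simp add: v w matrix_vector_right_distrib matrix_vector_mult_diff_distrib;
        simp add: w_def)+
  then have "(1 / 2) *\<^sub>R ((w + v) - (w - v)) \<in> span {\<eta>}"
    by (rule span_scale[OF span_diff])
  moreover have "(1 / 2) *\<^sub>R ((w + v) - (w - v)) = v"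
    by (simp add: vec_eq_iff)
  ultimately show "v \<in> span {\<eta>}"
    by simp
next
  fix v assume "v \<in> span {\<eta>}"
  then show "v \<in> {v. coeff_matrix A B *v v = 0}"
    using ker by (auto simp: span_singleton matrix_vector_mult_scaleR)
qed

text \<open>The kernel is the orthogonal complement of the row space, whose dimension is the
  rank.\<close>

lemma rank_nullity:
  fixes M :: "real ^ 'n ^ 'm"
  shows "rank M + dim {v. M *v v = 0} = CARD('n)"
proof -
  have row: "(M *v v) $ k = row k M \<bullet> v" for k v
    by (simp add: matrix_vector_mult_def row_def inner_vec_def)
  have "M *v v = 0 \<longleftrightarrow> (\<forall>x \<in> span (rows M). orthogonal x v)" for v
  proof
    assume "M *v v = 0"
    then show "\<forall>x \<in> span (rows M). orthogonal x v"
      using orthogonal_nullspace_rowspace orthogonal_commute by blast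
  next
    assume "\<forall>x \<in> span (rows M). orthogonal x v"
    then have "row k M \<bullet> v = 0" for k
      by (auto simp: rows_def orthogonal_def intro: span_base)
    then show "M *v v = 0"
      by (simp add: vec_eq_iff row)
  qed
  then have "dim {v. M *v v = 0} + dim (span (rows M)) = dim (UNIV :: (real ^ 'n) set)"
    using dim_subspace_orthogonal_to_vectors[of "span (rows M)" "UNIV :: (real ^ 'n) set"]
    by simp
  then show ?thesis
    by (simp add: row_rank_def)
qed

theorem theorem3:
  fixes A B :: "real ^ 'j ^ 'i"
  assumes "cond_prob_given_col A"
    and "cond_prob_given_row B"
    and "CARD('i) \<le> CARD('j)"
  shows "(rank (coeff_matrix A B) \<le> CARD('i) - 1 \<longrightarrow> compatible A B) \<and>
         ((\<exists>!\<eta> :: real ^ 'i. stochastic_vec \<eta> \<and> coeff_matrix A B *v \<eta> = 0) \<longrightarrow>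
            rank (coeff_matrix A B) = CARD('i) - 1)"
proof (intro conjI impI)
  assume "rank (coeff_matrix A B) \<le> CARD('i) - 1"
  \<comment> \<open>Subtraction on naturals truncates at 0; positivity makes the bound strictly
    smaller than the number of columns.\<close>
  moreover have "0 < CARD('i)"
    by simp
  ultimately have "rank (coeff_matrix A B) \<noteq> CARD('i)"
    by linarith
  then obtain v where v: "v \<noteq> 0" "coeff_matrix A B *v v = 0"
    using matrix_nonfull_linear_equations_eq by blast
  define w where "w = (\<chi> i. \<bar>v $ i\<bar>)"
  have w: "coeff_matrix A B *v w = 0"
    unfolding w_def using coeff_matrix_kernel_abs[OF assms(1,2) v(2)] .
  have "stochastic_vec ((1 / (\<Sum>i\<in>UNIV. w $ i)) *\<^sub>R w)"
    using v(1) by (intro stochastic_vec_normalize) (auto simp: w_def vec_eq_iff)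
  then show "compatible A B"
    by (rule compatible_if_kernel_stochastic[OF assms(2)])
      (simp add: matrix_vector_mult_scaleR w)
next
  assume "\<exists>!\<eta> :: real ^ 'i. stochastic_vec \<eta> \<and> coeff_matrix A B *v \<eta> = 0"
  then obtain \<eta> where \<eta>: "stochastic_vec \<eta>" "coeff_matrix A B *v \<eta> = 0"
    and uniq: "\<And>\<zeta>. stochastic_vec \<zeta> \<Longrightarrow> coeff_matrix A B *v \<zeta> = 0 \<Longrightarrow> \<zeta> = \<eta>"
    by blast
  \<comment> \<open>This makes the dimension of \<open>span {\<eta>}\<close> equal to 1 rather than
    0.\<close>
  have "\<eta> \<noteq> 0"
    using \<eta>(1) by (auto simp: stochastic_vec_def)
  then have "dim {v. coeff_matrix A B *v v = 0} = 1"
    by (simp add: coeff_matrix_kernel_eq_span[OF assms(1,2) \<eta>(2) uniq])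
  then show "rank (coeff_matrix A B) = CARD('i) - 1"
    using rank_nullity[of "coeff_matrix A B"] by simp
qed

end
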